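(* Let $n,m,p\ge1$, let $F,F':\mathbf{SVect}^n\to\mathbf{SVect}^m$ and $G,G':\mathbf{SVect}^m\to\mathbf{SVect}^p$ be $\mathbb C$-linear functors with rank matrices $\mathbf R^F,\mathbf R^{F'},\mathbf R^G,\mathbf R^{G'}$, and let $(s^G_1,\dots,s^G_p)$ and $(s^{G'}_1,\dots,s^{G'}_p)$ be the gauges of $G$ and $G'$. For any natural transformations $\tau:F\Rightarrow F'$ and $\sigma:G\Rightarrow G'$, the matrix $\mathbf T(\sigma\circ\tau)$ of the horizontal composite $\sigma\circ\tau:G\circ F\Rightarrow G'\circ F'$ is given by $$\mathbf T(\sigma\circ\tau)_{kj}=s^{G'}_k(\mathbf R^{F'}(\mathbf e_j))\left(\bigoplus_{i=1}^m\mathbf T(\sigma)_{ki}\otimes\mathbf T(\tau)_{ij}\right)s^G_k(\mathbf R^F(\mathbf e_j))^{-1}$$ for all $j=1,\dots,n$ and $k=1,\dots,p$.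
   Context: $\mathbb N=\{0,1,2,\dots\}$. $\mathbf{SVect}$ is the full subcategory of the category of finite dimensional complex vector spaces with objects $\mathbb C^a$, $a\ge0$; $\mathbf{SVect}^n$ is its $n$-fold product. A functor is $\mathbb C$-linear if it is $\mathbb C$-linear on hom spaces. A functor $F:\mathbf{SVect}^n\to\mathbf{SVect}^m$ has components $F_1,\dots,F_m$. $\mathbb C(j,n)=(0,\dots,0,\mathbb C,0,\dots,0)$ ($\mathbb C$ in position $j$). The rank matrix $\mathbf R^F$ has entries $R^F_{ij}=\dim F_i(\mathbb C(j,n))$; $\mathbf R_k$ denotes the $k$-th row of $\mathbf R$ and $\mathbf R(\mathbf e_j)$ its $j$-th column. $[f]$ is the matrix of a linear map in canonical bases; $\otimes$ is the Kronecker product (blocks $M_{uv}N$) and $\bigoplus$ the block diagonal sum. Matrices with zero rows or columns ("empty" matrices) are allowed with their sizes, so a $p\times0$ block in a direct sum contributes $p$ zero rows and a $0\times q$ block contributes $q$ zero columns. For $\tau:F\Rightarrow F'$, $\tau_{\mathbb C(j,n)}$ is an $m$-tuple of linear maps $\Phi(\tau)_{ij}:\mathbb C^{R^F_{ij}}\to\mathbb C^{R^{F'}_{ij}}$, and the matrix $\mathbf T(\tau)$ of $\tau$ is the $m\times n$ matrix with entries the matrices $\mathbf T(\tau)_{ij}=[\Phi(\tau)_{ij}]$. The same convention defines $\mathbf T(\sigma)$ and $\mathbf T(\sigma\circ\tau)$. Horizontal composition is the usual one: $(\sigma\circ\tau)_X=\sigma_{F'(X)}\circ G(\tau_X)$.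 Reference functors: for $\mathbf r\in\mathbb N^m$, $H(\mathbf r):\mathbf{SVect}^m\to\mathbf{SVect}$ sends $(\mathbb C^{a_1},\dots,\mathbb C^{a_m})$ to $\mathbb C^{\mathbf a\cdot\mathbf r}$, $\mathbf a\cdot\mathbf r=\sum_ia_ir_i$, and $[H(\mathbf r)(f_1,\dots,f_m)]=\bigoplus_{i=1}^m\mathrm{Id}_{r_i}\otimes[f_i]$. Gauge: for $\mathbf r\in\mathbb N^m$ let $\mathcal S(\mathbf r)$ be the set of families $s=(s(\mathbf a))_{\mathbf a\in\mathbb N^m}$ of invertible complex matrices $s(\mathbf a)$ of size $\mathbf a\cdot\mathbf r$ (trivial if $\mathbf a\cdot\mathbf r=0$) with $s(\mathbf e_i)=\mathrm{Id}_{r_i}$ for all $i$. The gauge of a $\mathbb C$-linear functor $G:\mathbf{SVect}^m\to\mathbf{SVect}^p$ with rank matrix $\mathbf R$ is the unique $(s_1,\dots,s_p)\in\mathcal S(\mathbf R_1)\times\cdots\times\mathcal S(\mathbf R_p)$ such that for every $k$ and every morphism $(f_1,\dots,f_m):(\mathbb C^{a_1},\dots,\mathbb C^{a_m})\to(\mathbb C^{a_1'},\dots,\mathbb C^{a_m'})$ one has $[G_k(f_1,\dots,f_m)]=s_k(\mathbf a')\,[H(\mathbf R_k)(f_1,\dots,f_m)]\,s_k(\mathbf a)^{-1}$. *)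

theory Defs
  imports
    "HOL-Library.FuncSet"
    "Jordan_Normal_Form.VS_Connect"
    "Jordan_Normal_Form.Gauss_Jordan_Elimination"
begin

text \<open>
  The space \<open>\<complex>\<^sup>a\<close> is \<open>carrier_vec a\<close>. Indices are 0-based, so position \<open>j = 1,\<dots>,n\<close> of the
  mathematical text is \<open>j < n\<close> here. Finite families indexed by \<open>{1,\<dots>,n}\<close> (objects and morphisms
  of \<open>SVect\<^sup>n\<close>, elements of \<open>\<nat>\<^sup>n\<close>) are vectors of dimension \<open>n\<close>; in particular the object
  \<open>(\<complex>\<^bsup>a\<^sub>1\<^esup>,\<dots>,\<complex>\<^bsup>a\<^sub>n\<^esup>)\<close> of \<open>SVect\<^sup>n\<close> is the vector \<open>a \<in> carrier_vec n\<close> of natural numbers, and both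
  \<open>\<complex>(j,n)\<close> and \<open>e\<^sub>j \<in> \<nat>\<^sup>n\<close> are \<open>unit_vec n j\<close>.
\<close>

subsection \<open>The category \<open>SVect\<close>\<close>

type_synonym lin = "complex vec \<Rightarrow> complex vec"

text \<open>Extensionality (the value \<open>undefined\<close> outside of \<open>carrier_vec a\<close>) makes equality in
  \<open>lin_hom a b\<close> the equality of linear maps.\<close>

definition lin_hom :: "nat \<Rightarrow> nat \<Rightarrow> lin set" where
  "lin_hom a b = {f \<in> extensional (carrier_vec a).
     linear_map (class_ring :: complex ring) (module_vec TYPE(complex) a) (module_vec TYPE(complex) b) f}"

definition lin_id :: "nat \<Rightarrow> lin" where
  "lin_id a = restrict (\<lambda>v. v) (carrier_vec a)"

definition lin_comp :: "nat \<Rightarrow> lin \<Rightarrow> lin \<Rightarrow> lin" where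
  "lin_comp a g f = compose (carrier_vec a) g f"

definition lin_add :: "nat \<Rightarrow> lin \<Rightarrow> lin \<Rightarrow> lin" where
  "lin_add a f g = restrict (\<lambda>v. f v + g v) (carrier_vec a)"

definition lin_smult :: "nat \<Rightarrow> complex \<Rightarrow> lin \<Rightarrow> lin" where
  "lin_smult a c f = restrict (\<lambda>v. c \<cdot>\<^sub>v f v) (carrier_vec a)"

text \<open>The matrix \<open>[f]\<close> of \<open>f : \<complex>\<^sup>a \<rightarrow> \<complex>\<^sup>b\<close> in the canonical bases, and the map of a given matrix.\<close>

definition mat_of_lin :: "nat \<Rightarrow> nat \<Rightarrow> lin \<Rightarrow> complex mat" where
  "mat_of_lin a b f = mat b a (\<lambda>(i, j). f (unit_vec a j) $ i)"

definition lin_of_mat :: "complex mat \<Rightarrow> lin" where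
  "lin_of_mat A = restrict (\<lambda>v. A *\<^sub>v v) (carrier_vec (dim_col A))"

lemma lin_hom_iff:
  "f \<in> lin_hom a b \<longleftrightarrow> f \<in> carrier_vec a \<rightarrow>\<^sub>E carrier_vec b \<and>
     (\<forall>u\<in>carrier_vec a. \<forall>v\<in>carrier_vec a. f (u + v) = f u + f v) \<and>
     (\<forall>c. \<forall>v\<in>carrier_vec a. f (c \<cdot>\<^sub>v v) = c \<cdot>\<^sub>v f v)"
proof -
  interpret A: vec_space "TYPE(complex)" a .
  interpret B: vec_space "TYPE(complex)" b .
  have "linear_map (class_ring :: complex ring) (module_vec TYPE(complex) a) (module_vec TYPE(complex) b) f
      \<longleftrightarrow> f \<in> LinearCombinations.module_hom class_ring (module_vec TYPE(complex) a) (module_vec TYPE(complex) b)"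
    unfolding linear_map_def mod_hom_def mod_hom_axioms_def
    using A.vectorspace_axioms B.vectorspace_axioms A.module_axioms B.module_axioms by blast
  then show ?thesis
    unfolding lin_hom_def LinearCombinations.module_hom_def PiE_def
    by (auto simp: module_vec_simps class_ring_simps)
qed

subsection \<open>The category \<open>SVect\<^sup>n\<close>\<close>

definition sv_hom :: "nat vec \<Rightarrow> nat vec \<Rightarrow> lin vec set" where
  "sv_hom a b = {f. dim_vec f = dim_vec a \<and> (\<forall>i<dim_vec a. f $ i \<in> lin_hom (a $ i) (b $ i))}"

definition sv_id :: "nat vec \<Rightarrow> lin vec" where
  "sv_id a = vec (dim_vec a) (\<lambda>i. lin_id (a $ i))"

definition sv_comp :: "nat vec \<Rightarrow> lin vec \<Rightarrow> lin vec \<Rightarrow> lin vec" where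
  "sv_comp a g f = vec (dim_vec a) (\<lambda>i. lin_comp (a $ i) (g $ i) (f $ i))"

definition sv_add :: "nat vec \<Rightarrow> lin vec \<Rightarrow> lin vec \<Rightarrow> lin vec" where
  "sv_add a f g = vec (dim_vec a) (\<lambda>i. lin_add (a $ i) (f $ i) (g $ i))"

definition sv_smult :: "nat vec \<Rightarrow> complex \<Rightarrow> lin vec \<Rightarrow> lin vec" where
  "sv_smult a c f = vec (dim_vec a) (\<lambda>i. lin_smult (a $ i) c (f $ i))"

subsection \<open>Functors and natural transformations\<close>

text \<open>The action on morphisms takes source and target as arguments: \<open>arr F a b\<close> is the map
  \<open>Hom(a,b) \<rightarrow> Hom(F a,F b)\<close>. The components of \<open>F\<close> are \<open>ob F a $ i\<close> and \<open>arr F a b f $ i\<close>.\<close>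

record sv_functor =
  ob :: "nat vec \<Rightarrow> nat vec"
  arr :: "nat vec \<Rightarrow> nat vec \<Rightarrow> lin vec \<Rightarrow> lin vec"

definition is_functor :: "nat \<Rightarrow> nat \<Rightarrow> sv_functor \<Rightarrow> bool" where
  "is_functor n m F \<longleftrightarrow>
     (\<forall>a\<in>carrier_vec n. ob F a \<in> carrier_vec m) \<and>
     (\<forall>a\<in>carrier_vec n. \<forall>b\<in>carrier_vec n. \<forall>f\<in>sv_hom a b. arr F a b f \<in> sv_hom (ob F a) (ob F b)) \<and>
     (\<forall>a\<in>carrier_vec n. arr F a a (sv_id a) = sv_id (ob F a)) \<and>
     (\<forall>a\<in>carrier_vec n. \<forall>b\<in>carrier_vec n. \<forall>c\<in>carrier_vec n. \<forall>f\<in>sv_hom a b. \<forall>g\<in>sv_hom b c.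
        arr F a c (sv_comp a g f) = sv_comp (ob F a) (arr F b c g) (arr F a b f))"

definition is_linear_functor :: "nat \<Rightarrow> nat \<Rightarrow> sv_functor \<Rightarrow> bool" where
  "is_linear_functor n m F \<longleftrightarrow> is_functor n m F \<and>
     (\<forall>a\<in>carrier_vec n. \<forall>b\<in>carrier_vec n.
        (\<forall>f\<in>sv_hom a b. \<forall>g\<in>sv_hom a b.
           arr F a b (sv_add a f g) = sv_add (ob F a) (arr F a b f) (arr F a b g)) \<and>
        (\<forall>c. \<forall>f\<in>sv_hom a b.
           arr F a b (sv_smult a c f) = sv_smult (ob F a) c (arr F a b f)))"

definition functor_comp :: "sv_functor \<Rightarrow> sv_functor \<Rightarrow> sv_functor" where
  "functor_comp G F = \<lparr>ob = (\<lambda>a. ob G (ob F a)),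
                       arr = (\<lambda>a b f. arr G (ob F a) (ob F b) (arr F a b f))\<rparr>"

type_synonym sv_transf = "nat vec \<Rightarrow> lin vec"

definition is_nat_transf :: "nat \<Rightarrow> sv_functor \<Rightarrow> sv_functor \<Rightarrow> sv_transf \<Rightarrow> bool" where
  "is_nat_transf n F F' \<tau> \<longleftrightarrow>
     (\<forall>a\<in>carrier_vec n. \<tau> a \<in> sv_hom (ob F a) (ob F' a)) \<and>
     (\<forall>a\<in>carrier_vec n. \<forall>b\<in>carrier_vec n. \<forall>f\<in>sv_hom a b.
        sv_comp (ob F a) (\<tau> b) (arr F a b f) = sv_comp (ob F a) (arr F' a b f) (\<tau> a))"

text \<open>\<open>(\<sigma> \<circ> \<tau>)\<^sub>X = \<sigma>\<^bsub>F'(X)\<^esub> \<circ> G(\<tau>\<^sub>X)\<close>, for \<open>\<tau> : F \<Rightarrow> F'\<close> and \<open>\<sigma> : G \<Rightarrow> G'\<close>.\<close>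

definition horizontal_comp ::
  "sv_functor \<Rightarrow> sv_functor \<Rightarrow> sv_functor \<Rightarrow> sv_transf \<Rightarrow> sv_transf \<Rightarrow> sv_transf" where
  "horizontal_comp F F' G \<sigma> \<tau> =
     (\<lambda>X. sv_comp (ob G (ob F X)) (\<sigma> (ob F' X)) (arr G (ob F X) (ob F' X) (\<tau> X)))"

subsection \<open>Rank matrices and matrices of natural transformations\<close>

definition rank_matrix :: "nat \<Rightarrow> nat \<Rightarrow> sv_functor \<Rightarrow> nat mat" where
  "rank_matrix n m F = mat m n (\<lambda>(i, j). ob F (unit_vec n j) $ i)"

definition transf_matrix :: "nat \<Rightarrow> nat \<Rightarrow> sv_functor \<Rightarrow> sv_functor \<Rightarrow> sv_transf \<Rightarrow> complex mat mat" where
  "transf_matrix n m F F' \<tau> = mat m n (\<lambda>(i, j).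
     mat_of_lin (rank_matrix n m F $$ (i, j)) (rank_matrix n m F' $$ (i, j)) (\<tau> (unit_vec n j) $ i))"

subsection \<open>Reference functors and gauges\<close>

definition kronecker :: "complex mat \<Rightarrow> complex mat \<Rightarrow> complex mat" where
  "kronecker M N = mat (dim_row M * dim_row N) (dim_col M * dim_col N)
     (\<lambda>(i, j). M $$ (i div dim_row N, j div dim_col N) * N $$ (i mod dim_row N, j mod dim_col N))"

text \<open>The reference functor \<open>H(r) : SVect\<^sup>m \<rightarrow> SVect\<close>, with \<open>m = dim_vec r\<close>.\<close>

definition H_ob :: "nat vec \<Rightarrow> nat vec \<Rightarrow> nat" where
  "H_ob r a = a \<bullet> r"

definition H_arr :: "nat vec \<Rightarrow> nat vec \<Rightarrow> nat vec \<Rightarrow> lin vec \<Rightarrow> lin" where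
  "H_arr r a b f = lin_of_mat (diag_block_mat
     (map (\<lambda>i. kronecker (1\<^sub>m (r $ i)) (mat_of_lin (a $ i) (b $ i) (f $ i))) [0..<dim_vec r]))"

definition mat_inv :: "complex mat \<Rightarrow> complex mat" where
  "mat_inv A = the (mat_inverse A)"

definition gauge_set :: "nat vec \<Rightarrow> (nat vec \<Rightarrow> complex mat) set" where
  "gauge_set r = {s.
     (\<forall>a\<in>carrier_vec (dim_vec r). s a \<in> carrier_mat (a \<bullet> r) (a \<bullet> r) \<and> invertible_mat (s a)) \<and>
     (\<forall>i<dim_vec r. s (unit_vec (dim_vec r) i) = 1\<^sub>m (r $ i))}"

text \<open>\<open>is_gauge m p G s\<close>: the family \<open>(s k)\<^bsub>k<p\<^esub>\<close> is the gauge of \<open>G : SVect\<^sup>m \<rightarrow> SVect\<^sup>p\<close>. The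
  conditions determine \<open>s k a\<close> for \<open>k < p\<close> and \<open>a \<in> \<nat>\<^sup>m\<close>; other values of \<open>s\<close> are irrelevant.\<close>

definition is_gauge :: "nat \<Rightarrow> nat \<Rightarrow> sv_functor \<Rightarrow> (nat \<Rightarrow> nat vec \<Rightarrow> complex mat) \<Rightarrow> bool" where
  "is_gauge m p G s \<longleftrightarrow>
     (\<forall>k<p. s k \<in> gauge_set (row (rank_matrix m p G) k) \<and>
        (\<forall>a\<in>carrier_vec m. \<forall>b\<in>carrier_vec m. \<forall>f\<in>sv_hom a b.
           mat_of_lin (ob G a $ k) (ob G b $ k) (arr G a b f $ k) =
             s k b *
             mat_of_lin (H_ob (row (rank_matrix m p G) k) a) (H_ob (row (rank_matrix m p G) k) b)
               (H_arr (row (rank_matrix m p G) k) a b f) *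
             mat_inv (s k a)))"

end

theory Submission
  imports Defs
begin

text \<open>
  Fix \<open>k\<close>, let \<open>R\<close>, \<open>R'\<close> be the \<open>k\<close>-th rows of the rank matrices of \<open>G\<close>, \<open>G'\<close>, let \<open>T\<^sub>i\<close> be the matrix of
  \<open>\<sigma>\<close> at the \<open>i\<close>-th unit vector \<open>e\<^sub>i\<close>, and put \<open>K(a) = \<Oplus>\<^sub>i T\<^sub>i \<otimes> Id\<close>, with identities of sizes \<open>a\<^sub>i\<close>. The mixed
  product rule makes \<open>K\<close> a natural transformation \<open>H(R) \<Rightarrow> H(R')\<close>, and \<open>K(e\<^sub>i) = T\<^sub>i\<close>. The matrix
  \<open>S = s'(b)\<^sup>-\<^sup>1 [\<sigma>\<^sub>b] s(b)\<close> also satisfies the naturality equations for the coordinate inclusions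
  \<open>\<iota> : e\<^sub>i \<rightarrow> b\<close>, because gauges are trivial at \<open>e\<^sub>i\<close>; hence \<open>S H(\<iota>) = K(b) H(\<iota>)\<close> for all of them, and since
  the columns of the matrices \<open>H(\<iota>)\<close> exhaust the unit vectors, \<open>S = K(b)\<close>. The claim follows by
  multiplying \<open>[\<sigma>\<^sub>b]\<close> with \<open>[G(\<tau>)]\<close>, again by the mixed product rule.
\<close>

section \<open>Kronecker products and block diagonal sums\<close>

lemma dim_kronecker [simp]:
  "dim_row (kronecker A B) = dim_row A * dim_row B"
  "dim_col (kronecker A B) = dim_col A * dim_col B"
  by (simp_all add: kronecker_def)

lemma index_kronecker:
  "i < dim_row A * dim_row B \<Longrightarrow> j < dim_col A * dim_col B \<Longrightarrow>
    kronecker A B $$ (i, j) =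
      A $$ (i div dim_row B, j div dim_col B) * B $$ (i mod dim_row B, j mod dim_col B)"
  by (simp add: kronecker_def)

text \<open>Written with \<open>Suc 0\<close>, the simplifier's form of \<open>1\<close>; it
  evaluates the only nonempty block of \<open>K(e_i)\<close>.\<close>

lemma kronecker_one_right [simp]: "kronecker A (1\<^sub>m (Suc 0)) = A"
  by (intro eq_matI) (auto simp: index_kronecker)

text \<open>The indices \<open>q < m * k\<close> form \<open>m\<close> consecutive runs of length
  \<open>k\<close>; run \<open>i\<close> consists of the \<open>q = i * k + j\<close> with
  \<open>j < k\<close>.\<close>

lemma sum_div_mod:
  fixes f :: "nat \<Rightarrow> nat \<Rightarrow> 'a :: comm_monoid_add"
  shows "(\<Sum>q<m * k. f (q div k) (q mod k)) = (\<Sum>i<m. \<Sum>j<k. f i j)"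
proof -
  have "(\<Sum>q\<in>{i * k..<i * k + k}. f (q div k) (q mod k)) =
      (\<Sum>j<k. f ((i * k + j) div k) ((i * k + j) mod k))" for i
    by (rule sum.reindex_bij_witness[where i = "\<lambda>j. i * k + j" and j = "\<lambda>q. q - i * k"]) auto
  then show ?thesis
    by (simp flip: sum.nat_group)
qed

text \<open>The inner index of the product encodes a pair \<open>(u, v)\<close>, and the summand is
  a term in \<open>u\<close> times a term in \<open>v\<close>, so the double sum factors.\<close>

lemma kronecker_mult:
  assumes "dim_col A = dim_row C" and "dim_col B = dim_row D"
  shows "kronecker A B * kronecker C D = kronecker (A * C) (B * D)"
proof (rule eq_matI)
  fix i j
  assume "i < dim_row (kronecker (A * C) (B * D))" "j < dim_col (kronecker (A * C) (B * D))"
  then have i: "i < dim_row A * dim_row B" and j: "j < dim_col C * dim_col D" by simp_all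
  let ?i = "i div dim_row B" and ?x = "i mod dim_row B"
    and ?j = "j div dim_col D" and ?y = "j mod dim_col D"
  define g where "g u v = (A $$ (?i, u) * C $$ (u, ?j)) * (B $$ (?x, v) * D $$ (v, ?y))" for u v
  \<comment> \<open>The bounds on the remainders need nonzero divisors; a zero divisor would leave
    no index \<open>i\<close> or \<open>j\<close>.\<close>
  have i': "?i < dim_row A" "?x < dim_row B" and j': "?j < dim_col C" "?y < dim_col D"
    using i j by (simp_all add: less_mult_imp_div_less)
      (metis mod_less_divisor mult_0_right neq0_conv not_less_zero)+
  have "(kronecker A B * kronecker C D) $$ (i, j) =
      (\<Sum>q<dim_row C * dim_row D. kronecker A B $$ (i, q) * kronecker C D $$ (q, j))"
    using i j assms by (simp add: scalar_prod_def atLeast0LessThan)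
  also have "\<dots> = (\<Sum>q<dim_row C * dim_row D. g (q div dim_row D) (q mod dim_row D))"
    using i j assms by (intro sum.cong) (simp_all add: index_kronecker g_def ac_simps)
  also have "\<dots> = (\<Sum>u<dim_row C. A $$ (?i, u) * C $$ (u, ?j)) *
      (\<Sum>v<dim_row D. B $$ (?x, v) * D $$ (v, ?y))"
    unfolding sum_div_mod by (simp add: sum_product g_def)
  also have "\<dots> = kronecker (A * C) (B * D) $$ (i, j)"
    using i j i' j' assms by (simp add: index_kronecker scalar_prod_def atLeast0LessThan)
  finally show "(kronecker A B * kronecker C D) $$ (i, j) = kronecker (A * C) (B * D) $$ (i, j)" .
qed (simp_all add: assms)

section \<open>Block diagonal matrices\<close>

text \<open>Splitting off the first blocks gives a product of two 2-by-2 block matrices whose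
  off-diagonal blocks vanish; the rest is induction.\<close>

lemma diag_block_mat_mult:
  fixes As Bs :: "'a :: semiring_0 mat list"
  assumes "list_all2 (\<lambda>A B. dim_col A = dim_row B) As Bs"
  shows "diag_block_mat As * diag_block_mat Bs = diag_block_mat (map2 (*) As Bs)"
  using assms
proof (induction rule: list_all2_induct)
  case (Cons A As B Bs)
  let ?DA = "diag_block_mat As" and ?DB = "diag_block_mat Bs"
  have "list_all2 (=) (map dim_col As) (map dim_row Bs)"
    using Cons.hyps(2) by (simp add: list.rel_map)
  then have d: "dim_col ?DA = dim_row ?DB"
    by (simp add: dim_diag_block_mat list.rel_eq)
  note hyp = Cons.hyps(1)
  have "diag_block_mat (A # As) * diag_block_mat (B # Bs) =
      four_block_mat A (0\<^sub>m (dim_row A) (dim_col ?DA)) (0\<^sub>m (dim_row ?DA) (dim_col A)) ?DA *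
      four_block_mat B (0\<^sub>m (dim_row B) (dim_col ?DB)) (0\<^sub>m (dim_row ?DB) (dim_col B)) ?DB"
    by (simp add: Let_def)
  also have "\<dots> = four_block_mat
      (A * B + 0\<^sub>m (dim_row A) (dim_col ?DA) * 0\<^sub>m (dim_row ?DB) (dim_col B))
      (A * 0\<^sub>m (dim_row B) (dim_col ?DB) + 0\<^sub>m (dim_row A) (dim_col ?DA) * ?DB)
      (0\<^sub>m (dim_row ?DA) (dim_col A) * B + ?DA * 0\<^sub>m (dim_row ?DB) (dim_col B))
      (0\<^sub>m (dim_row ?DA) (dim_col A) * 0\<^sub>m (dim_row B) (dim_col ?DB) + ?DA * ?DB)"
    by (rule mult_four_block_mat[of _ "dim_row A" "dim_col A" _ "dim_col ?DA" _ "dim_row ?DA"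
          _ _ "dim_col B" _ "dim_col ?DB"]) (use hyp d in \<open>auto intro: carrier_matI\<close>)
  \<comment> \<open>The zero blocks are given the sizes of the products, as in the unfolding of
    \<open>diag_block_mat\<close> on the list of products.\<close>
  also have "\<dots> = four_block_mat (A * B) (0\<^sub>m (dim_row (A * B)) (dim_col (?DA * ?DB)))
      (0\<^sub>m (dim_row (?DA * ?DB)) (dim_col (A * B))) (?DA * ?DB)"
  proof -
    have "A * B + 0\<^sub>m (dim_row A) (dim_col ?DA) * 0\<^sub>m (dim_row ?DB) (dim_col B) = A * B"
      by (rule eq_matI) (use d in \<open>auto simp: scalar_prod_def\<close>)
    moreover have "A * 0\<^sub>m (dim_row B) (dim_col ?DB) + 0\<^sub>m (dim_row A) (dim_col ?DA) * ?DB =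
        0\<^sub>m (dim_row (A * B)) (dim_col (?DA * ?DB))"
      by (rule eq_matI) (use hyp d in \<open>auto simp: scalar_prod_def\<close>)
    moreover have "0\<^sub>m (dim_row ?DA) (dim_col A) * B + ?DA * 0\<^sub>m (dim_row ?DB) (dim_col B) =
        0\<^sub>m (dim_row (?DA * ?DB)) (dim_col (A * B))"
      by (rule eq_matI) (use hyp d in \<open>auto simp: scalar_prod_def\<close>)
    moreover have "0\<^sub>m (dim_row ?DA) (dim_col A) * 0\<^sub>m (dim_row B) (dim_col ?DB) + ?DA * ?DB = ?DA * ?DB"
      by (rule eq_matI) (use hyp in \<open>auto simp: scalar_prod_def\<close>)
    ultimately show ?thesis by (simp only:)
  qed
  also have "\<dots> = diag_block_mat (map2 (*) (A # As) (B # Bs))"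
    by (simp add: Let_def Cons.IH[symmetric] del: index_mult_mat)
  finally show ?case .
qed simp

text \<open>With block heights \<open>ns\<close>, this locates row \<open>q\<close> of a block
  diagonal matrix; blocks of height zero are skipped because \<open>x < ns ! i\<close> is
  strict.\<close>

lemma index_sum_list_block:
  fixes ns :: "nat list"
  assumes "q < sum_list ns"
  obtains i x where "i < length ns" "x < ns ! i" "q = sum_list (take i ns) + x"
proof -
  have "\<exists>i<length ns. \<exists>x<ns ! i. q = sum_list (take i ns) + x"
    using assms
  proof (induction ns arbitrary: q)
    case (Cons n ns)
    show ?case
    proof (cases "q < n")
      case True
      then show ?thesis by (intro exI[of _ 0]) auto
    next
      case False
      with Cons.prems have "q - n < sum_list ns" by auto
      from Cons.IH[OF this]
      obtain i x where "i < length ns" "x < ns ! i" "q - n = sum_list (take i ns) + x"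
        by blast
      with False show ?thesis by (intro exI[of _ "Suc i"]) auto
    qed
  qed simp
  then show ?thesis using that by blast
qed

text \<open>Outside its own block a column is filled up with zeros, so a unit column stays one, its
  1 moved down by the heights of the preceding blocks. The column index \<open>y'\<close> stays
  existential, as only the position of the 1 matters later.\<close>

lemma diag_block_mat_unit_col:
  assumes "i < length As" and "y < dim_col (As ! i)"
    and "\<forall>z<dim_row (As ! i). As ! i $$ (z, y) = (if z = x then 1 else 0)" and "x < dim_row (As ! i)"
  shows "\<exists>y'<dim_col (diag_block_mat As). \<forall>z<dim_row (diag_block_mat As).
    diag_block_mat As $$ (z, y') = (if z = sum_list (map dim_row (take i As)) + x then 1 else 0)"
  using assms
proof (induction As arbitrary: i)
  case (Cons A As)
  show ?case
  proof (cases i)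
    case 0
    have y: "y < dim_col A" and x: "x < dim_row A"
      and A: "\<And>z. z < dim_row A \<Longrightarrow> A $$ (z, y) = (if z = x then 1 else 0)"
      using Cons.prems 0 by simp_all
    show ?thesis
      using x y 0 by (intro exI[of _ y]) (auto simp: Let_def A)
  next
    case (Suc i')
    define x' where "x' = sum_list (map dim_row (take i' As)) + x"
    have "i' < length As" "y < dim_col (As ! i')" "x < dim_row (As ! i')"
      "\<forall>z<dim_row (As ! i'). As ! i' $$ (z, y) = (if z = x then 1 else 0)"
      using Cons.prems Suc by simp_all
    from Cons.IH[OF this(1,2,4,3)] obtain y' where y': "y' < dim_col (diag_block_mat As)"
      and c: "\<And>z. z < dim_row (diag_block_mat As) \<Longrightarrow>
        diag_block_mat As $$ (z, y') = (if z = x' then 1 else 0)"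
      unfolding x'_def by blast
    have "sum_list (map dim_row (take i (A # As))) + x = dim_row A + x'"
      by (simp add: x'_def Suc)
    then show ?thesis
      using y' by (intro exI[of _ "dim_col A + y'"]) (auto simp: Let_def c)
  qed
qed simp

lemma four_block_mat_empty [simp]:
  "four_block_mat A (0\<^sub>m (dim_row A) 0) (0\<^sub>m 0 (dim_col A)) (0\<^sub>m 0 0) = A"
  "four_block_mat (0\<^sub>m 0 0) (0\<^sub>m 0 (dim_col A)) (0\<^sub>m (dim_row A) 0) A = A"
  by (auto intro!: eq_matI)

lemma diag_block_mat_zero_blocks:
  "set As \<subseteq> {0\<^sub>m 0 0} \<Longrightarrow> diag_block_mat As = 0\<^sub>m 0 0"
proof (induction As)
  case (Cons A As)
  then have "A = 0\<^sub>m 0 0" and "diag_block_mat As = 0\<^sub>m 0 0" by simp_all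
  then show ?case using four_block_mat_empty(1)[of "0\<^sub>m 0 0"] by (simp add: Let_def)
qed simp

text \<open>Meant for \<open>K(e_i)\<close>: away from position \<open>i\<close> the blocks are
  Kronecker products with an identity of size 0, hence empty in both directions.\<close>

lemma diag_block_mat_single:
  fixes As :: "'a :: zero mat list"
  assumes "i < length As" and "\<forall>j<length As. j \<noteq> i \<longrightarrow> As ! j = 0\<^sub>m 0 0"
  shows "diag_block_mat As = As ! i"
  using assms
proof (induction As arbitrary: i)
  case (Cons A As)
  have As: "As ! j = 0\<^sub>m 0 0" if "j < length As" "Suc j \<noteq> i" for j
    using Cons.prems(2)[rule_format, of "Suc j"] that by simp
  show ?case
  proof (cases i)
    case 0
    then have "set As \<subseteq> {0\<^sub>m 0 0}" using As by (auto simp: in_set_conv_nth)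
    then have "diag_block_mat As = 0\<^sub>m 0 0" by (rule diag_block_mat_zero_blocks)
    with 0 show ?thesis by (simp add: Let_def)
  next
    case (Suc i')
    have "\<forall>j<length As. j \<noteq> i' \<longrightarrow> As ! j = 0\<^sub>m 0 0" using As Suc by blast
    then have "diag_block_mat As = As ! i'"
      using Cons.IH[of i'] Cons.prems(1) Suc by simp
    moreover have "A = 0\<^sub>m 0 0" using Cons.prems(2)[rule_format, of 0] Suc by simp
    ultimately show ?thesis using Suc by (simp add: Let_def)
  qed
qed simp

section \<open>Block sums of Kronecker products and their columns\<close>

text \<open>The matrices of \<open>H(r)\<close> on morphisms (all \<open>M i\<close> identities),
  the transformation \<open>K\<close> (all \<open>N i\<close> identities) and the sum in the theorem
  all have this form, so one product rule serves for them.\<close>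

definition kron_sum :: "nat \<Rightarrow> (nat \<Rightarrow> complex mat) \<Rightarrow> (nat \<Rightarrow> complex mat) \<Rightarrow> complex mat" where
  "kron_sum m M N = diag_block_mat (map (\<lambda>i. kronecker (M i) (N i)) [0..<m])"

lemma dim_kron_sum [simp]:
  "dim_row (kron_sum m M N) = (\<Sum>i<m. dim_row (M i) * dim_row (N i))"
  "dim_col (kron_sum m M N) = (\<Sum>i<m. dim_col (M i) * dim_col (N i))"
  by (simp_all add: kron_sum_def dim_diag_block_mat o_def interv_sum_list_conv_sum_set_nat
      atLeast0LessThan)

lemma kron_sum_cong:
  "(\<And>i. i < m \<Longrightarrow> M i = M' i) \<Longrightarrow> (\<And>i. i < m \<Longrightarrow> N i = N' i) \<Longrightarrow> kron_sum m M N = kron_sum m M' N'"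
  unfolding kron_sum_def by (intro arg_cong[where f = diag_block_mat] map_cong) auto

lemma kron_sum_mult:
  assumes "\<And>i. i < m \<Longrightarrow> dim_col (M i) = dim_row (M' i)"
    and "\<And>i. i < m \<Longrightarrow> dim_col (N i) = dim_row (N' i)"
  shows "kron_sum m M N * kron_sum m M' N' = kron_sum m (\<lambda>i. M i * M' i) (\<lambda>i. N i * N' i)"
proof -
  have "kron_sum m M N * kron_sum m M' N' =
    diag_block_mat (map2 (*) (map (\<lambda>i. kronecker (M i) (N i)) [0..<m])
      (map (\<lambda>i. kronecker (M' i) (N' i)) [0..<m]))"
    unfolding kron_sum_def
    by (rule diag_block_mat_mult) (simp add: assms list_all2_conv_all_nth)
  also have "map2 (*) (map (\<lambda>i. kronecker (M i) (N i)) [0..<m])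
      (map (\<lambda>i. kronecker (M' i) (N' i)) [0..<m]) =
      map (\<lambda>i. kronecker (M i * M' i) (N i * N' i)) [0..<m]"
    by (rule nth_equalityI) (simp_all add: kronecker_mult assms)
  finally show ?thesis by (simp add: kron_sum_def)
qed

text \<open>For \<open>Q\<close> and \<open>R\<close> take the inverse of the gauge of
  \<open>G\<close> at \<open>b\<close> and that gauge itself: these are the inner factors when
  \<open>[\<sigma> b]\<close> is multiplied with \<open>[G(\<tau>)]\<close>.\<close>

lemma mult_mat_cancel_middle:
  fixes P :: "'a :: semiring_1 mat"
  assumes P: "P \<in> carrier_mat a b" and K: "K \<in> carrier_mat b c" and Q: "Q \<in> carrier_mat c d"
    and R: "R \<in> carrier_mat d c" and H: "H \<in> carrier_mat c e" and S: "S \<in> carrier_mat e f"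
    and QR: "Q * R = 1\<^sub>m c"
  shows "(P * K * Q) * (R * H * S) = P * (K * H) * S"
proof -
  have PK: "P * K \<in> carrier_mat a c" and HS: "H * S \<in> carrier_mat c f" using P K H S by simp_all
  have "(P * K * Q) * (R * H * S) = P * K * (Q * R * (H * S))"
    using assoc_mult_mat[OF R H S] assoc_mult_mat[OF PK Q mult_carrier_mat[OF R HS]]
      assoc_mult_mat[OF Q R HS]
    by simp
  also have "\<dots> = P * (K * H) * S"
    using assoc_mult_mat[OF P K HS] assoc_mult_mat[OF K H S]
      assoc_mult_mat[OF P mult_carrier_mat[OF K H] S]
    by (simp add: QR left_mult_one_mat[OF HS])
  finally show ?thesis .
qed

lemma mult_mat_unit_vec:
  fixes A :: "'a :: semiring_1 mat"
  shows "A \<in> carrier_mat b a \<Longrightarrow> j < a \<Longrightarrow> A *\<^sub>v unit_vec a j = col A j"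
  by (intro eq_vecI) auto

text \<open>The \<open>i\<close>-th member of this family is the \<open>l\<close>-th coordinate column, the others are empty.\<close>

definition coord_incl :: "nat \<Rightarrow> nat vec \<Rightarrow> nat \<Rightarrow> nat \<Rightarrow> nat \<Rightarrow> complex mat" where
  "coord_incl m a i l u = mat (a $ u) (unit_vec m i $ u) (\<lambda>(x, y). if x = l then 1 else 0)"

lemma dim_coord_incl [simp]:
  "dim_row (coord_incl m a i l u) = a $ u"
  "dim_col (coord_incl m a i l u) = unit_vec m i $ u"
  by (simp_all add: coord_incl_def)

text \<open>Every unit vector is a column of one of the matrices \<open>kron_sum m (\<lambda>u. 1\<^sub>m (r u)) (coord_incl m a i l)\<close>.\<close>

lemma eq_mat_if_eq_on_coord_incl:
  assumes S: "S \<in> carrier_mat d (\<Sum>u<m. r u * a $ u)" and K: "K \<in> carrier_mat d (\<Sum>u<m. r u * a $ u)"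
    and eq: "\<And>i l. i < m \<Longrightarrow> l < a $ i \<Longrightarrow>
      S * kron_sum m (\<lambda>u. 1\<^sub>m (r u)) (coord_incl m a i l) =
      K * kron_sum m (\<lambda>u. 1\<^sub>m (r u)) (coord_incl m a i l)"
  shows "S = K"
proof (rule mat_col_eqI)
  let ?d = "\<Sum>u<m. r u * a $ u"
  fix q assume "q < dim_col K"
  with K have q: "q < ?d" by simp
  let ?ns = "map (\<lambda>u. r u * a $ u) [0..<m]"
  have "q < sum_list ?ns"
    using q by (simp add: interv_sum_list_conv_sum_set_nat atLeast0LessThan)
  then obtain i x where i: "i < m" and x: "x < r i * a $ i" and qe: "q = sum_list (take i ?ns) + x"
    by (rule index_sum_list_block) auto
  \<comment> \<open>Block \<open>i\<close> is an identity of size \<open>r i\<close> tensored with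
    the single column that has its 1 in row \<open>l\<close>. Its column \<open>w\<close> thus has
    its 1 in row \<open>w * a $ i + l\<close>, which is \<open>x\<close> for these values.\<close>
  let ?w = "x div a $ i" and ?l = "x mod a $ i"
  have l: "?l < a $ i" and w: "?w < r i"
    using x by (auto simp: less_mult_imp_div_less)
      (metis mod_less_divisor mult_0_right neq0_conv not_less_zero)
  let ?As = "map (\<lambda>u. kronecker (1\<^sub>m (r u)) (coord_incl m a i ?l u)) [0..<m]"
  let ?D = "kron_sum m (\<lambda>u. 1\<^sub>m (r u)) (coord_incl m a i ?l)"
  have "\<forall>z<dim_row (?As ! i). ?As ! i $$ (z, ?w) = (if z = x then 1 else 0)"
  proof (intro allI impI)
    fix z assume "z < dim_row (?As ! i)"
    then have z: "z < r i * a $ i" using i by simp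
    then have z': "z div a $ i < r i" "z mod a $ i < a $ i"
      using l by (auto simp: less_mult_imp_div_less)
    have "(z div a $ i = ?w \<and> z mod a $ i = ?l) = (z = x)"
      by (metis div_mult_mod_eq)
    then show "?As ! i $$ (z, ?w) = (if z = x then 1 else 0)"
      using i z z' w l by (auto simp: index_kronecker coord_incl_def)
  qed
  then have "\<exists>y<dim_col (diag_block_mat ?As). \<forall>z<dim_row (diag_block_mat ?As).
      diag_block_mat ?As $$ (z, y) = (if z = sum_list (map dim_row (take i ?As)) + x then 1 else 0)"
    using i x w by (intro diag_block_mat_unit_col[where y = ?w]) simp_all
  moreover have "sum_list (map dim_row (take i ?As)) = sum_list (take i ?ns)"
    by (simp add: take_map o_def)
  ultimately obtain y where y: "y < dim_col ?D"
    and Dy: "\<And>z. z < ?d \<Longrightarrow> ?D $$ (z, y) = (if z = q then 1 else 0)"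
    unfolding kron_sum_def[symmetric] qe dim_kron_sum by auto
  have D: "col ?D y = unit_vec ?d q"
    by (rule eq_vecI) (use y Dy q in auto)
  have Dc: "?D \<in> carrier_mat ?d (dim_col ?D)" by (intro carrier_matI) simp_all
  \<comment> \<open>Column \<open>y\<close> of \<open>?D\<close> is a unit vector, so column
    \<open>y\<close> of a product with \<open>?D\<close> is column \<open>q\<close> of the left
    factor.\<close>
  have "col S q = S *\<^sub>v unit_vec ?d q" using S q by (simp add: mult_mat_unit_vec)
  also have "\<dots> = col (S * ?D) y" by (simp only: col_mult2[OF S Dc y] D)
  also have "\<dots> = col (K * ?D) y" using eq[OF i l] by simp
  also have "\<dots> = K *\<^sub>v unit_vec ?d q" by (simp only: col_mult2[OF K Dc y] D)
  also have "\<dots> = col K q" using K q by (simp add: mult_mat_unit_vec)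
  finally show "col S q = col K q" .
qed (use S K in auto)

section \<open>Inverse matrices\<close>

text \<open>An invertible matrix is a unit of the ring of \<open>n\<close>-by-\<open>n\<close>
  matrices, so \<open>mat_inverse\<close> does not return \<open>None\<close> and \<open>the\<close>
  yields a genuine inverse.\<close>

lemma mat_inv:
  assumes "A \<in> carrier_mat n n" and "invertible_mat A"
  shows "mat_inv A \<in> carrier_mat n n" "A * mat_inv A = 1\<^sub>m n" "mat_inv A * A = 1\<^sub>m n"
proof -
  obtain B where AB: "A * B = 1\<^sub>m n" and "B * A = 1\<^sub>m (dim_row B)"
    using assms by (auto simp: invertible_mat_def inverts_mat_def)
  \<comment> \<open>\<open>invertible_mat\<close> leaves the size of \<open>B\<close> open;
    comparing the column counts in the two products fixes it.\<close>
  moreover from AB this(2) have "B \<in> carrier_mat n n"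
    using assms(1) by (metis carrier_matD carrier_matI index_mult_mat(2,3) index_one_mat(2,3))
  ultimately have "A \<in> Units (ring_mat TYPE(complex) n ())"
    using assms(1) by (auto simp: Units_def ring_mat_def)
  then obtain B where "mat_inverse A = Some B"
    using mat_inverse(1)[OF assms(1), of "()"] by (cases "mat_inverse A") auto
  from mat_inverse(2)[OF assms(1) this] this
  show "mat_inv A \<in> carrier_mat n n" "A * mat_inv A = 1\<^sub>m n" "mat_inv A * A = 1\<^sub>m n"
    by (auto simp: mat_inv_def)
qed

lemma mat_inv_one [simp]: "mat_inv (1\<^sub>m n) = 1\<^sub>m n"
proof -
  have "invertible_mat (1\<^sub>m n :: complex mat)"
    by (auto simp: invertible_mat_def inverts_mat_def intro!: exI[of _ "1\<^sub>m n"])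
  from mat_inv[OF one_carrier_mat this] show ?thesis by simp
qed

section \<open>Matrices of linear maps\<close>

lemma dim_mat_of_lin [simp]:
  "dim_row (mat_of_lin a b f) = b" "dim_col (mat_of_lin a b f) = a"
  "mat_of_lin a b f \<in> carrier_mat b a"
  by (simp_all add: mat_of_lin_def)

lemma lin_hom_carrier: "f \<in> lin_hom a b \<Longrightarrow> v \<in> carrier_vec a \<Longrightarrow> f v \<in> carrier_vec b"
  by (auto simp: lin_hom_iff)

lemma lin_hom_eq_mult_mat_vec:
  assumes f: "f \<in> lin_hom a b" and v: "v \<in> carrier_vec a"
  shows "f v = mat_of_lin a b f *\<^sub>v v"
proof -
  \<comment> \<open>Keeping only the first \<open>n\<close> coordinates turns the expansion of
    \<open>v\<close> in the canonical basis into an induction adding one term at a time.\<close>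
  define trunc where "trunc n = vec a (\<lambda>i. if i < n then v $ i else 0)" for n
  have add: "f (u + w) = f u + f w" if "u \<in> carrier_vec a" "w \<in> carrier_vec a" for u w
    using f that by (auto simp: lin_hom_iff)
  have smult: "f (c \<cdot>\<^sub>v u) = c \<cdot>\<^sub>v f u" if "u \<in> carrier_vec a" for u c
    using f that by (auto simp: lin_hom_iff)
  have "f (trunc n) = mat_of_lin a b f *\<^sub>v trunc n" if "n \<le> a" for n
    using that
  proof (induction n)
    case 0
    \<comment> \<open>Writing the zero vector as a multiple by the scalar 0 lets homogeneity give
      \<open>f 0 = 0\<close>.\<close>
    have z: "trunc 0 = 0 \<cdot>\<^sub>v 0\<^sub>v a" by (auto simp: trunc_def)
    have "f (trunc 0) = 0 \<cdot>\<^sub>v f (0\<^sub>v a)"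
      unfolding z by (rule smult) auto
    also have "\<dots> = mat_of_lin a b f *\<^sub>v trunc 0"
      using lin_hom_carrier[OF f, of "0\<^sub>v a"] unfolding z by (intro eq_vecI) auto
    finally show ?case .
  next
    case (Suc n)
    have s: "trunc (Suc n) = trunc n + v $ n \<cdot>\<^sub>v unit_vec a n"
      using Suc.prems by (intro eq_vecI) (auto simp: trunc_def less_Suc_eq)
    have c: "trunc n \<in> carrier_vec a" by (simp add: trunc_def)
    have u: "f (unit_vec a n) = mat_of_lin a b f *\<^sub>v unit_vec a n"
      using lin_hom_carrier[OF f, of "unit_vec a n"] Suc.prems
      by (intro eq_vecI) (auto simp: mult_mat_unit_vec[of _ b a] mat_of_lin_def)
    have "f (trunc (Suc n)) = f (trunc n) + v $ n \<cdot>\<^sub>v f (unit_vec a n)"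
      unfolding s using c by (simp add: add smult)
    also have "\<dots> = mat_of_lin a b f *\<^sub>v trunc n + v $ n \<cdot>\<^sub>v (mat_of_lin a b f *\<^sub>v unit_vec a n)"
      using Suc u by simp
    also have "\<dots> = mat_of_lin a b f *\<^sub>v trunc (Suc n)"
      unfolding s using c
      by (simp add: mult_add_distrib_mat_vec[of _ b a] mult_mat_vec[of _ b a])
    finally show ?case .
  qed
  moreover have "trunc a = v" using v by (auto simp: trunc_def)
  ultimately show ?thesis by force
qed

lemma mat_of_lin_comp:
  assumes f: "f \<in> lin_hom a b" and g: "g \<in> lin_hom b c"
  shows "mat_of_lin a c (lin_comp a g f) = mat_of_lin b c g * mat_of_lin a b f"
proof (rule eq_matI)
  fix i j assume "i < dim_row (mat_of_lin b c g * mat_of_lin a b f)"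
    and "j < dim_col (mat_of_lin b c g * mat_of_lin a b f)"
  then have i: "i < c" and j: "j < a" by simp_all
  have fj: "f (unit_vec a j) = col (mat_of_lin a b f) j"
    using j by (simp add: lin_hom_eq_mult_mat_vec[OF f] mult_mat_unit_vec[of _ b a])
  have "lin_comp a g f (unit_vec a j) = mat_of_lin b c g *\<^sub>v col (mat_of_lin a b f) j"
    using lin_hom_carrier[OF f, of "unit_vec a j"]
    by (simp add: lin_comp_def compose_def lin_hom_eq_mult_mat_vec[OF g] fj)
  then show "mat_of_lin a c (lin_comp a g f) $$ (i, j) = (mat_of_lin b c g * mat_of_lin a b f) $$ (i, j)"
    using i j by (simp add: mat_of_lin_def[of a c])
qed simp_all

lemma lin_of_mat_hom: "A \<in> carrier_mat b a \<Longrightarrow> lin_of_mat A \<in> lin_hom a b"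
  by (auto simp: lin_hom_iff lin_of_mat_def mult_add_distrib_mat_vec mult_mat_vec)

lemma mat_of_lin_of_mat: "A \<in> carrier_mat b a \<Longrightarrow> mat_of_lin a b (lin_of_mat A) = A"
  by (intro eq_matI) (auto simp: mat_of_lin_def lin_of_mat_def mult_mat_unit_vec[of _ b a])

section \<open>Functors, gauges and natural transformations\<close>

lemma functor_obD:
  "is_linear_functor n m F \<Longrightarrow> a \<in> carrier_vec n \<Longrightarrow> ob F a \<in> carrier_vec m"
  by (simp add: is_linear_functor_def is_functor_def)

lemma functor_arrD:
  "is_linear_functor n m F \<Longrightarrow> a \<in> carrier_vec n \<Longrightarrow> b \<in> carrier_vec n \<Longrightarrow> f \<in> sv_hom a b \<Longrightarrow> i < m \<Longrightarrow>
    arr F a b f $ i \<in> lin_hom (ob F a $ i) (ob F b $ i)"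
  using functor_obD[of n m F a]
  by (auto simp: is_linear_functor_def is_functor_def sv_hom_def)

lemma sv_id_hom: "sv_id a \<in> sv_hom a a"
  by (auto simp: sv_hom_def sv_id_def lin_id_def lin_hom_iff)

lemma nat_transfD:
  "is_nat_transf n F F' \<tau> \<Longrightarrow> is_linear_functor n m F \<Longrightarrow> a \<in> carrier_vec n \<Longrightarrow> i < m \<Longrightarrow>
    \<tau> a $ i \<in> lin_hom (ob F a $ i) (ob F' a $ i)"
  using functor_obD[of n m F a] by (auto simp: is_nat_transf_def sv_hom_def)

lemma nat_transf_natural:
  assumes \<tau>: "is_nat_transf n F F' \<tau>" and F: "is_linear_functor n m F" and F': "is_linear_functor n m F'"
    and a: "a \<in> carrier_vec n" and b: "b \<in> carrier_vec n" and f: "f \<in> sv_hom a b" and i: "i < m"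
  shows "mat_of_lin (ob F b $ i) (ob F' b $ i) (\<tau> b $ i) * mat_of_lin (ob F a $ i) (ob F b $ i) (arr F a b f $ i) =
    mat_of_lin (ob F' a $ i) (ob F' b $ i) (arr F' a b f $ i) * mat_of_lin (ob F a $ i) (ob F' a $ i) (\<tau> a $ i)"
proof -
  have "sv_comp (ob F a) (\<tau> b) (arr F a b f) $ i = sv_comp (ob F a) (arr F' a b f) (\<tau> a) $ i"
    using \<tau> a b f by (auto simp: is_nat_transf_def)
  then have "lin_comp (ob F a $ i) (\<tau> b $ i) (arr F a b f $ i) =
      lin_comp (ob F a $ i) (arr F' a b f $ i) (\<tau> a $ i)"
    using functor_obD[OF F a] i by (simp add: sv_comp_def)
  then show ?thesis
    by (simp flip: mat_of_lin_comp[OF functor_arrD[OF F a b f i] nat_transfD[OF \<tau> F b i]]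
        mat_of_lin_comp[OF nat_transfD[OF \<tau> F a i] functor_arrD[OF F' a b f i]])
qed

section \<open>Reference functors and gauges in matrix form\<close>

lemma scalar_prod_eq_sum:
  fixes a r :: "nat vec"
  shows "r \<in> carrier_vec m \<Longrightarrow> a \<bullet> r = (\<Sum>i<m. r $ i * a $ i)"
  by (auto simp: scalar_prod_def atLeast0LessThan mult.commute)

text \<open>The widths and heights of the blocks add up to \<open>H_ob r a\<close> and
  \<open>H_ob r b\<close>, so \<open>mat_of_lin\<close> undoes the \<open>lin_of_mat\<close> in
  \<open>H_arr\<close>.\<close>

lemma mat_of_lin_H_arr:
  assumes "r \<in> carrier_vec m"
  shows "mat_of_lin (H_ob r a) (H_ob r b) (H_arr r a b f) =
    kron_sum m (\<lambda>i. 1\<^sub>m (r $ i)) (\<lambda>i. mat_of_lin (a $ i) (b $ i) (f $ i))"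
proof -
  have "H_arr r a b f = lin_of_mat (kron_sum m (\<lambda>i. 1\<^sub>m (r $ i)) (\<lambda>i. mat_of_lin (a $ i) (b $ i) (f $ i)))"
    using assms by (simp add: H_arr_def kron_sum_def)
  then show ?thesis
    using assms by (simp add: H_ob_def scalar_prod_eq_sum mat_of_lin_of_mat carrier_matI)
qed

lemma gaugeD:
  fixes m p k :: nat and G :: sv_functor
  defines "r \<equiv> row (rank_matrix m p G) k"
  assumes G: "is_linear_functor m p G" and s: "is_gauge m p G s" and k: "k < p"
  shows "a \<in> carrier_vec m \<Longrightarrow> s k a \<in> carrier_mat (a \<bullet> r) (a \<bullet> r)"
    and "a \<in> carrier_vec m \<Longrightarrow> invertible_mat (s k a)"
    and "i < m \<Longrightarrow> s k (unit_vec m i) = 1\<^sub>m (r $ i)"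
    and "a \<in> carrier_vec m \<Longrightarrow> b \<in> carrier_vec m \<Longrightarrow> f \<in> sv_hom a b \<Longrightarrow>
      mat_of_lin (ob G a $ k) (ob G b $ k) (arr G a b f $ k) =
        s k b * kron_sum m (\<lambda>i. 1\<^sub>m (r $ i)) (\<lambda>i. mat_of_lin (a $ i) (b $ i) (f $ i)) * mat_inv (s k a)"
    and "a \<in> carrier_vec m \<Longrightarrow> ob G a $ k = a \<bullet> r"
proof -
  have r: "r \<in> carrier_vec m" by (simp add: r_def rank_matrix_def carrier_vecI)
  have set: "s k \<in> gauge_set r"
    using s k by (simp add: is_gauge_def r_def)
  show 1: "s k a \<in> carrier_mat (a \<bullet> r) (a \<bullet> r)" if "a \<in> carrier_vec m" for a
    using set that r by (simp add: gauge_set_def)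
  show "invertible_mat (s k a)" if "a \<in> carrier_vec m"
    using set that r by (simp add: gauge_set_def)
  show "s k (unit_vec m i) = 1\<^sub>m (r $ i)" if "i < m"
    using set that r by (simp add: gauge_set_def)
  show arr: "mat_of_lin (ob G a $ k) (ob G b $ k) (arr G a b f $ k) =
      s k b * kron_sum m (\<lambda>i. 1\<^sub>m (r $ i)) (\<lambda>i. mat_of_lin (a $ i) (b $ i) (f $ i)) * mat_inv (s k a)"
    if "a \<in> carrier_vec m" "b \<in> carrier_vec m" "f \<in> sv_hom a b" for a b f
    using s k that by (simp add: is_gauge_def mat_of_lin_H_arr[OF r] flip: r_def)
  \<comment> \<open>Comparing the number of rows in the gauge equation of an identity morphism.\<close>
  show "ob G a $ k = a \<bullet> r" if "a \<in> carrier_vec m"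
    using arg_cong[OF arr[OF that that sv_id_hom], of dim_row] 1[OF that] by simp
qed

text \<open>Up to the gauges, \<open>\<sigma>\<close> is the transformation \<open>K\<close> of
  reference functors built from its components at the unit vectors; the theorem needs this at
  \<open>b = F'(e_j)\<close>.\<close>

lemma nat_transf_gauge:
  fixes m p k :: nat and G G' :: sv_functor and \<sigma> :: sv_transf
  defines "T \<equiv> \<lambda>i. transf_matrix m p G G' \<sigma> $$ (k, i)"
  assumes G: "is_linear_functor m p G" and G': "is_linear_functor m p G'"
    and s: "is_gauge m p G s" and s': "is_gauge m p G' s'"
    and \<sigma>: "is_nat_transf m G G' \<sigma>" and k: "k < p" and b: "b \<in> carrier_vec m"
  shows "mat_of_lin (ob G b $ k) (ob G' b $ k) (\<sigma> b $ k) =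
    s' k b * kron_sum m T (\<lambda>i. 1\<^sub>m (b $ i)) * mat_inv (s k b)"
proof -
  define r where "r = row (rank_matrix m p G) k"
  define r' where "r' = row (rank_matrix m p G') k"
  have r: "r \<in> carrier_vec m" and r': "r' \<in> carrier_vec m"
    by (simp_all add: r_def r'_def rank_matrix_def carrier_vecI)
  note g = gaugeD[OF G s k, folded r_def] and g' = gaugeD[OF G' s' k, folded r'_def]
  have T: "T i = mat_of_lin (r $ i) (r' $ i) (\<sigma> (unit_vec m i) $ k)"
    and ob: "ob G (unit_vec m i) $ k = r $ i" "ob G' (unit_vec m i) $ k = r' $ i" if "i < m" for i
    using that k by (simp_all add: T_def transf_matrix_def r_def r'_def rank_matrix_def)
  let ?d = "b \<bullet> r" and ?d' = "b \<bullet> r'"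
  note d = scalar_prod_eq_sum[OF r, of b] and d' = scalar_prod_eq_sum[OF r', of b]
  define M where "M = mat_of_lin (ob G b $ k) (ob G' b $ k) (\<sigma> b $ k)"
  have M: "M \<in> carrier_mat ?d' ?d" using g(5)[OF b] g'(5)[OF b] by (simp add: M_def)
  have sb: "s k b \<in> carrier_mat ?d ?d" and sb': "s' k b \<in> carrier_mat ?d' ?d'"
    using g(1) g'(1) b by auto
  note i = mat_inv[OF g(1,2)[OF b]] and i' = mat_inv[OF g'(1,2)[OF b]]
  define K where "K = kron_sum m T (\<lambda>i. 1\<^sub>m (b $ i))"
  have K: "K \<in> carrier_mat ?d' ?d"
    unfolding K_def d d' by (rule carrier_matI) (simp_all add: T)
  let ?S = "mat_inv (s' k b) * M * s k b"
  have S: "?S \<in> carrier_mat ?d' ?d" using sb i' M by simp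
  have "?S = K"
  proof (rule eq_mat_if_eq_on_coord_incl)
    fix u l assume u: "u < m" and l: "l < b $ u"
    let ?e = "unit_vec m u"
    \<comment> \<open>The inclusion of coordinate \<open>l\<close> of summand \<open>u\<close>; the
      other components start at the zero space.\<close>
    let ?f = "vec m (\<lambda>v. lin_of_mat (coord_incl m b u l v))"
    have c: "coord_incl m b u l v \<in> carrier_mat (b $ v) (?e $ v)" for v
      by (simp add: coord_incl_def)
    have f: "?f \<in> sv_hom ?e b"
      using b by (auto simp: sv_hom_def intro: lin_of_mat_hom[OF c])
    let ?I = "kron_sum m (\<lambda>v. 1\<^sub>m (r $ v)) (coord_incl m b u l)"
    let ?I' = "kron_sum m (\<lambda>v. 1\<^sub>m (r' $ v)) (coord_incl m b u l)"
    \<comment> \<open>Entries of the unit vector stay unexpanded here, so that the sum matches the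
      column counts of \<open>?I\<close> and \<open>?I'\<close>.\<close>
    have de: "(\<Sum>v<m. x $ v * unit_vec m u $ v) = x $ u" if "x \<in> carrier_vec m" for x :: "nat vec"
      using scalar_prod_eq_sum[OF that, of "unit_vec m u"] that u by (simp del: index_unit_vec)
    have I: "?I \<in> carrier_mat ?d (r $ u)" and I': "?I' \<in> carrier_mat ?d' (r' $ u)"
      unfolding d d' by (rule carrier_matI; simp add: de r r' del: index_unit_vec)+
    have e: "?e \<in> carrier_vec m" by simp
    have fm: "kron_sum m R (\<lambda>v. mat_of_lin (?e $ v) (b $ v) (?f $ v)) = kron_sum m R (coord_incl m b u l)" for R
      by (rule kron_sum_cong) (simp_all add: mat_of_lin_of_mat[OF c] del: index_unit_vec)
    \<comment> \<open>The source is a unit vector, where the gauge is the identity, so only the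
      factor at the target \<open>b\<close> survives.\<close>
    have Gf: "mat_of_lin (ob G ?e $ k) (ob G b $ k) (arr G ?e b ?f $ k) = s k b * ?I"
      using g(4)[OF e b f]
      unfolding fm g(3)[OF u] mat_inv_one right_mult_one_mat[OF mult_carrier_mat[OF sb I]] .
    have G'f: "mat_of_lin (ob G' ?e $ k) (ob G' b $ k) (arr G' ?e b ?f $ k) = s' k b * ?I'"
      using g'(4)[OF e b f]
      unfolding fm g'(3)[OF u] mat_inv_one right_mult_one_mat[OF mult_carrier_mat[OF sb' I']] .
    have nat: "M * (s k b * ?I) = s' k b * ?I' * T u"
      using nat_transf_natural[OF \<sigma> G G' e b f k] unfolding Gf G'f by (simp only: M_def T[OF u] ob[OF u])
    have Tu: "T u \<in> carrier_mat (r' $ u) (r $ u)" using T[OF u] by simp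
    \<comment> \<open>This is \<open>K(e_u) = T u\<close>; only as a block sum can
      \<open>T u\<close> enter the mixed product rule.\<close>
    have TK: "T u = kron_sum m T (\<lambda>v. 1\<^sub>m (?e $ v))"
    proof -
      have "kron_sum m T (\<lambda>v. 1\<^sub>m (?e $ v)) = map (\<lambda>v. kronecker (T v) (1\<^sub>m (?e $ v))) [0..<m] ! u"
        unfolding kron_sum_def
        by (rule diag_block_mat_single) (use u in \<open>auto simp: kronecker_def intro!: eq_matI\<close>)
      then show ?thesis using u by simp
    qed
    have "?S * ?I = mat_inv (s' k b) * (M * (s k b * ?I))"
      using i' M sb I by (simp add: assoc_mult_mat[of _ ?d' ?d' _ ?d _ "r $ u"]
          assoc_mult_mat[of _ ?d' ?d' _ ?d _ ?d] assoc_mult_mat[of _ ?d' ?d _ ?d _ "r $ u"])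
    also have "\<dots> = mat_inv (s' k b) * s' k b * (?I' * T u)"
      by (simp only: nat assoc_mult_mat[OF sb' I' Tu] assoc_mult_mat[OF i'(1) sb' mult_carrier_mat[OF I' Tu]])
    also have "\<dots> = ?I' * T u"
      by (simp only: i'(3) left_mult_one_mat[OF mult_carrier_mat[OF I' Tu]])
    also have "\<dots> = kron_sum m (\<lambda>v. 1\<^sub>m (r' $ v) * T v) (\<lambda>v. coord_incl m b u l v * 1\<^sub>m (?e $ v))"
      unfolding TK by (rule kron_sum_mult) (simp_all add: T)
    \<comment> \<open>Naturality of \<open>K\<close>: in each block the identities change
      sides.\<close>
    also have "\<dots> = kron_sum m (\<lambda>v. T v * 1\<^sub>m (r $ v)) (\<lambda>v. 1\<^sub>m (b $ v) * coord_incl m b u l v)"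
    proof (rule kron_sum_cong)
      fix v assume "v < m"
      then have "T v \<in> carrier_mat (r' $ v) (r $ v)" using T by simp
      then show "1\<^sub>m (r' $ v) * T v = T v * 1\<^sub>m (r $ v)" by simp
      show "coord_incl m b u l v * 1\<^sub>m (?e $ v) = 1\<^sub>m (b $ v) * coord_incl m b u l v"
        using c[of v] by (simp del: index_unit_vec)
    qed
    also have "\<dots> = K * ?I"
      unfolding K_def by (rule kron_sum_mult[symmetric]) (simp_all add: T)
    finally show "?S * ?I = K * ?I" .
  qed (use S K d in simp_all)
  then have "s' k b * K * mat_inv (s k b) = s' k b * ?S * mat_inv (s k b)" by simp
  also have "\<dots> = s' k b * (mat_inv (s' k b) * M)"
    by (simp only: assoc_mult_mat[OF i'(1) M sb] assoc_mult_mat[OF M sb i(1)] i(2) right_mult_one_mat[OF M]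
        assoc_mult_mat[OF sb' mult_carrier_mat[OF i'(1) mult_carrier_mat[OF M sb]] i(1)]
        assoc_mult_mat[OF i'(1) mult_carrier_mat[OF M sb] i(1)])
  also have "\<dots> = M"
    by (simp only: assoc_mult_mat[OF sb' i'(1) M, symmetric] i'(2) left_mult_one_mat[OF M])
  finally show ?thesis by (simp add: M_def K_def)
qed

section \<open>Matrices of horizontal composites\<close>

theorem theorem3p14:
  fixes n m p :: nat
    and F F' G G' :: sv_functor
    and sG sG' :: "nat \<Rightarrow> nat vec \<Rightarrow> complex mat"
    and \<tau> \<sigma> :: sv_transf
  assumes "n \<ge> 1" and "m \<ge> 1" and "p \<ge> 1"
    and "is_linear_functor n m F" and "is_linear_functor n m F'"
    and "is_linear_functor m p G" and "is_linear_functor m p G'"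
    and "is_gauge m p G sG" and "is_gauge m p G' sG'"
    and "is_nat_transf n F F' \<tau>" and "is_nat_transf m G G' \<sigma>"
  shows "\<forall>j<n. \<forall>k<p.
    transf_matrix n p (functor_comp G F) (functor_comp G' F') (horizontal_comp F F' G \<sigma> \<tau>) $$ (k, j) =
      sG' k (col (rank_matrix n m F') j) *
      diag_block_mat (map (\<lambda>i. kronecker (transf_matrix m p G G' \<sigma> $$ (k, i))
                                         (transf_matrix n m F F' \<tau> $$ (i, j))) [0..<m]) *
      mat_inv (sG k (col (rank_matrix n m F) j))"
proof (intro allI impI)
  fix j k assume j: "j < n" and k: "k < p"
  note F = assms(4,5) and G = assms(6,7) and s = assms(8) and s' = assms(9)
    and \<tau> = assms(10) and \<sigma> = assms(11)
  let ?e = "unit_vec n j"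
  define a where "a = ob F ?e"
  define b where "b = ob F' ?e"
  have e: "?e \<in> carrier_vec n" by simp
  have a: "a \<in> carrier_vec m" and b: "b \<in> carrier_vec m"
    using functor_obD[OF F(1) e] functor_obD[OF F(2) e] by (simp_all add: a_def b_def)
  \<comment> \<open>The columns list the components of \<open>F\<close> and \<open>F'\<close> at the
    \<open>j\<close>-th unit vector, so the gauges in the formula are taken at the objects
    \<open>a\<close> and \<open>b\<close>.\<close>
  have col: "col (rank_matrix n m F) j = a" "col (rank_matrix n m F') j = b"
    using j a b by (auto simp: rank_matrix_def a_def b_def intro!: eq_vecI)
  have \<tau>e: "\<tau> ?e \<in> sv_hom a b" using \<tau> e by (auto simp: is_nat_transf_def a_def b_def)
  define r where "r = row (rank_matrix m p G) k"
  define r' where "r' = row (rank_matrix m p G') k"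
  have r: "r \<in> carrier_vec m" and r': "r' \<in> carrier_vec m"
    by (simp_all add: r_def r'_def rank_matrix_def carrier_vecI)
  note g = gaugeD[OF G(1) s k, folded r_def] and g' = gaugeD[OF G(2) s' k, folded r'_def]
  let ?T = "\<lambda>i. transf_matrix m p G G' \<sigma> $$ (k, i)"
  let ?t = "\<lambda>i. transf_matrix n m F F' \<tau> $$ (i, j)"
  have T: "?T i \<in> carrier_mat (r' $ i) (r $ i)" if "i < m" for i
    using that k by (simp add: transf_matrix_def r_def r'_def rank_matrix_def)
  have t: "?t i = mat_of_lin (a $ i) (b $ i) (\<tau> ?e $ i)" if "i < m" for i
    using that j by (simp add: transf_matrix_def a_def b_def rank_matrix_def)
  let ?K = "kron_sum m ?T (\<lambda>i. 1\<^sub>m (b $ i))"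
  let ?H = "kron_sum m (\<lambda>i. 1\<^sub>m (r $ i)) (\<lambda>i. mat_of_lin (a $ i) (b $ i) (\<tau> ?e $ i))"
  let ?a = "a \<bullet> r" and ?b = "b \<bullet> r" and ?b' = "b \<bullet> r'"
  have K: "?K \<in> carrier_mat ?b' ?b" and H: "?H \<in> carrier_mat ?b ?a"
    unfolding scalar_prod_eq_sum[OF r] scalar_prod_eq_sum[OF r']
    by (rule carrier_matI; simp add: carrier_matD[OF T])+
  note sa = mat_inv[OF g(1,2)[OF a]] and sb = g(1)[OF b] mat_inv[OF g(1,2)[OF b]]
    and sb' = g'(1)[OF b]
  \<comment> \<open>The identities in \<open>K\<close> meet the matrices of \<open>\<tau>\<close>
    and those in \<open>H\<close> meet the matrices of \<open>\<sigma>\<close>, which leaves the sum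
    in the theorem.\<close>
  have KH: "?K * ?H = kron_sum m ?T ?t"
  proof -
    have "?K * ?H = kron_sum m (\<lambda>i. ?T i * 1\<^sub>m (r $ i))
        (\<lambda>i. 1\<^sub>m (b $ i) * mat_of_lin (a $ i) (b $ i) (\<tau> ?e $ i))"
      using T by (intro kron_sum_mult) auto
    also have "\<dots> = kron_sum m ?T ?t"
      by (rule kron_sum_cong) (simp_all add: t right_mult_one_mat[OF T] left_mult_one_mat[OF dim_mat_of_lin(3)])
    finally show ?thesis .
  qed
  have "transf_matrix n p (functor_comp G F) (functor_comp G' F') (horizontal_comp F F' G \<sigma> \<tau>) $$ (k, j) =
      mat_of_lin (ob G a $ k) (ob G' b $ k) (lin_comp (ob G a $ k) (\<sigma> b $ k) (arr G a b (\<tau> ?e) $ k))"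
    using j k functor_obD[OF G(1) a]
    by (simp add: transf_matrix_def rank_matrix_def functor_comp_def horizontal_comp_def sv_comp_def
        flip: a_def b_def)
  also have "\<dots> = mat_of_lin (ob G b $ k) (ob G' b $ k) (\<sigma> b $ k) *
      mat_of_lin (ob G a $ k) (ob G b $ k) (arr G a b (\<tau> ?e) $ k)"
    by (rule mat_of_lin_comp[OF functor_arrD[OF G(1) a b \<tau>e k] nat_transfD[OF \<sigma> G(1) b k]])
  also have "\<dots> = (sG' k b * ?K * mat_inv (sG k b)) * (sG k b * ?H * mat_inv (sG k a))"
    by (simp only: nat_transf_gauge[OF G s s' \<sigma> k b] g(4)[OF a b \<tau>e])
  also have "\<dots> = sG' k b * (?K * ?H) * mat_inv (sG k a)"
    by (rule mult_mat_cancel_middle[OF sb' K sb(2,1) H sa(1) sb(4)])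
  finally show "transf_matrix n p (functor_comp G F) (functor_comp G' F') (horizontal_comp F F' G \<sigma> \<tau>) $$ (k, j) =
      sG' k (col (rank_matrix n m F') j) *
      diag_block_mat (map (\<lambda>i. kronecker (?T i) (?t i)) [0..<m]) *
      mat_inv (sG k (col (rank_matrix n m F) j))"
    unfolding KH col by (simp only: kron_sum_def)
qed

end
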